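(* Let $d\ge 2$, let $X\subset\mathbb{R}^d\setminus\{0\}$ be a finite set, and let $w:X\to\mathbb{R}_{>0}$. Write $RX=\{\|x\|: x\in X\}$ and $x'=x/\|x\|$. Let $f:\mathbb{R}_{>0}^2\times[-1,1]\to\mathbb{R}$, $g_0:\mathbb{R}_{>0}^2\to\mathbb{R}$, and $g_{ij}:\mathbb{R}_{>0}\to\mathbb{R}$ for $i\ge 0$, $j\ge 1$. Put \[h(r,s,t)=g_0(r,s)+\sum_{i\ge 0,\ j\ge 1} g_{ij}(r)g_{ij}(s)Q_j(t),\] and suppose $f(r,s,t)\ge h(r,s,t)$ for all $r,s\in RX$ and $t\in[-1,1]$. Then \[PE_f(X,w)\ \ge\ \sum_{x,y\in X} w(x)w(y)\,g_0(\|x\|,\|y\|)\;-\;\sum_{x\in X} w(x)^2\,h(\|x\|,\|x\|,1).\] Moreover, equality holds if and only if $f(\|x\|,\|y\|,x'\cdot y')=h(\|x\|,\|y\|,x'\cdot y')$ for all distinct $x,y\in X$, and \[\sum_{x,y\in X} w(x)w(y)\,g_{ij}(\|x\|)g_{ij}(\|y\|)\,Q_j(x'\cdot y')=0\quad\text{for all } i\ge 0,\ j\ge 1.\]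
   Context: $Q_j=Q_j^{(d)}$ denotes the Gegenbauer polynomial of degree $j$ for the sphere $S^{d-1}$: the polynomials $\{Q_j\}$ are orthogonal on $[-1,1]$ with respect to the weight $(1-t^2)^{(d-3)/2}$, normalized so that $Q_j(1)=\dim \mathrm{Harm}_j(\mathbb{R}^d)$, where $\mathrm{Harm}_j(\mathbb{R}^d)$ is the space of homogeneous harmonic polynomials of degree $j$ in $d$ variables. The potential energy of $(X,w)$ for $f$ is $PE_f(X,w)=\sum_{x,y\in X,\,x\ne y} w(x)w(y) f(\|x\|,\|y\|,x'\cdot y')$. Here $\|\cdot\|$ is the Euclidean norm and $\cdot$ the standard inner product. *)

theory Defs
  imports
    "HOL-Analysis.Analysis"
    "HOL-Library.Function_Algebras"
    "HOL-Computational_Algebra.Polynomial"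
begin

text \<open>
  Polynomials in \<open>d\<close> real variables are taken as polynomial functions on
  \<^typ>\<open>real ^ 'n\<close>, with \<open>d = CARD('n)\<close>.  The iterated \<^const>\<open>deriv\<close> below is the second
  partial derivative in a coordinate direction; polynomial functions are smooth, so it is
  never a junk value where it is used.
\<close>

definition laplacian :: "(real ^ 'n \<Rightarrow> real) \<Rightarrow> real ^ 'n \<Rightarrow> real" where
  "laplacian p x = (\<Sum>k\<in>UNIV. (deriv ^^ 2) (\<lambda>t. p (x + t *\<^sub>R axis k 1)) 0)"

definition Harm :: "nat \<Rightarrow> (real ^ 'n \<Rightarrow> real) set" where
  "Harm j = {p. real_polynomial_function p
               \<and> (\<forall>c x. p (c *\<^sub>R x) = c ^ j * p x)
               \<and> (\<forall>x. laplacian p x = 0)}"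

text \<open>
  The function space is not an instance of \<^class>\<open>real_vector\<close>, so its dimension is taken with
  respect to the explicit pointwise scalar multiplication.
\<close>

definition dim_Harm :: "'n::finite itself \<Rightarrow> nat \<Rightarrow> nat" where
  "dim_Harm (_ :: 'n itself) j =
     vector_space.dim (\<lambda>(c::real) p x. c * p x) (Harm j :: (real ^ 'n \<Rightarrow> real) set)"

text \<open>
  The three conditions determine the family uniquely.  For \<open>d = 2\<close> the weight is unbounded at
  the end points (where \<^const>\<open>powr\<close> returns \<open>0\<close>) but integrable.
\<close>

definition gegenbauer_family :: "'n::finite itself \<Rightarrow> (nat \<Rightarrow> real poly) \<Rightarrow> bool" where
  "gegenbauer_family (T :: 'n itself) Q \<longleftrightarrow>
     (\<forall>j. degree (Q j) = j) \<and>
     (\<forall>i j. i \<noteq> j \<longrightarrow>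
        ((\<lambda>t. poly (Q i) t * poly (Q j) t * (1 - t\<^sup>2) powr ((real CARD('n) - 3) / 2))
           has_integral 0) {-1..1}) \<and>
     (\<forall>j. poly (Q j) 1 = real (dim_Harm T j))"

text \<open>
  The normalised vector \<open>x' = x / norm x\<close> is \<^term>\<open>sgn x\<close>.
\<close>

definition potential_energy ::
  "(real \<Rightarrow> real \<Rightarrow> real \<Rightarrow> real) \<Rightarrow> (real ^ 'n) set \<Rightarrow> (real ^ 'n \<Rightarrow> real) \<Rightarrow> real" where
  "potential_energy f X w =
     (\<Sum>x\<in>X. \<Sum>y\<in>X - {x}. w x * w y * f (norm x) (norm y) (sgn x \<bullet> sgn y))"

definition h_term ::
  "(nat \<Rightarrow> nat \<Rightarrow> real \<Rightarrow> real) \<Rightarrow> (nat \<Rightarrow> real poly) \<Rightarrow> real \<Rightarrow> real \<Rightarrow> real \<Rightarrow> nat \<times> nat \<Rightarrow> real" where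
  "h_term g Q r s t = (\<lambda>(i, j). g i j r * g i j s * poly (Q j) t)"

text \<open>
  The double series is an unordered sum.  This costs no generality: for \<open>r = s\<close> and \<open>t = 1\<close> all
  terms are nonnegative, so convergence in any order is absolute there, and
  \<open>\<bar>Q j t\<bar> \<le> Q j 1\<close> then gives absolute convergence everywhere.
\<close>

definition h_fun ::
  "(real \<Rightarrow> real \<Rightarrow> real) \<Rightarrow> (nat \<Rightarrow> nat \<Rightarrow> real \<Rightarrow> real) \<Rightarrow> (nat \<Rightarrow> real poly)
     \<Rightarrow> real \<Rightarrow> real \<Rightarrow> real \<Rightarrow> real" where
  "h_fun g0 g Q r s t = g0 r s + (\<Sum>\<^sub>\<infinity>ij\<in>UNIV \<times> {1..}. h_term g Q r s t ij)"

end

theory Submission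
  imports Defs
begin

text \<open>
  The only substantial input is that the Gegenbauer polynomials are positive definite on the
  sphere.  The operator \<open>(1 - t\<^sup>2) p'' - (d - 1) t p'\<close> is symmetric for the weight and does not
  raise degrees, so by orthogonality \<open>Q j\<close> is an eigenvector of it.  On coefficients, this
  differential equation says exactly that the homogenized zonal polynomial
  \<open>H x z = norm z ^ j * Q j (x \<bullet> sgn z)\<close> is harmonic in \<open>z\<close>.  In the Fischer inner product,
  multiplication by \<open>z \<bullet> z\<close> is adjoint to the Laplacian and \<open>(y \<bullet> z) ^ j\<close> reproduces values at
  \<open>y\<close> up to the factor \<open>fact j\<close>; hence the product of \<open>H x\<close> and \<open>H y\<close> is a multiple of
  \<open>Q j (x \<bullet> y)\<close>, and these values form a Gram matrix.  The sign of the multiple is fixed by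
  \<open>Q j 1 \<ge> 0\<close>.

  Summing over \<open>X\<close>, the potential energy minus the claimed bound is the sum of the
  nonnegative contributions of \<open>f - h\<close> off the diagonal and of the nonnegative quadratic forms
  of the individual terms of \<open>h - g0\<close>, so it vanishes iff each of them does.
\<close>

section \<open>The Gegenbauer differential equation\<close>

text \<open>Sturm-Liouville form: times the weight it is the derivative of
  \<open>(1 - t^2) powr ((d - 1) / 2) * p'\<close> on the open interval.\<close>

definition gegenbauer_op :: "real \<Rightarrow> real poly \<Rightarrow> real poly" where
  "gegenbauer_op d p =
     [:1, 0, -1:] * pderiv (pderiv p) - smult (d - 1) ([:0, 1:] * pderiv p)"

lemma coeff_gegenbauer_op:
  "coeff (gegenbauer_op d p) n =
     real (n + 2) * real (n + 1) * coeff p (n + 2) - real n * (real n + d - 2) * coeff p n"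
proof -
  have *: "[:1, 0, -1:] * q = q - pCons 0 (pCons 0 q)" for q :: "real poly"
    by simp
  show ?thesis
    unfolding gegenbauer_op_def *
    by (cases n; cases "n - 1") (auto simp: coeff_pderiv algebra_simps)
qed

text \<open>On the open interval the integrand is the derivative of \<open>F\<close>, which vanishes
  at both end points because the exponent \<open>(d - 1) / 2\<close> is positive.\<close>

lemma has_integral_gegenbauer_boundary:
  fixes d :: real and r :: "real poly"
  assumes "d > 1"
  shows "((\<lambda>t. poly ([:1, 0, -1:] * pderiv r - smult (d - 1) ([:0, 1:] * r)) t
            * (1 - t\<^sup>2) powr ((d - 3) / 2)) has_integral 0) {-1..1}"
proof -
  define F where "F t = (1 - t\<^sup>2) powr ((d - 1) / 2) * poly r t" for t :: real
  have cont: "continuous_on {-1..1} F"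
    unfolding F_def using assms
    by (intro continuous_intros continuous_on_powr') (auto simp: abs_square_le_1)
  have der: "(F has_vector_derivative
      poly ([:1, 0, -1:] * pderiv r - smult (d - 1) ([:0, 1:] * r)) t
        * (1 - t\<^sup>2) powr ((d - 3) / 2)) (at t)" if "t \<in> {-1<..<1}" for t
  proof -
    have pos: "1 - t\<^sup>2 > 0" using that by (auto simp: abs_square_less_1 abs_if)
    have e: "(d - 3) / 2 = (d - 1) / 2 - 1" by (simp add: field_simps)
    have p: "(1 - t\<^sup>2) powr ((d - 1) / 2) = (1 - t\<^sup>2) * (1 - t\<^sup>2) powr ((d - 3) / 2)"
      unfolding e using pos by (simp add: powr_diff)
    have "((\<lambda>t. (1 - t\<^sup>2) powr ((d - 1) / 2)) has_real_derivative
             (d - 1) / 2 * (1 - t\<^sup>2) powr ((d - 1) / 2 - 1) * (- 2 * t)) (at t)"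
      using pos by (auto intro!: derivative_eq_intros)
    from DERIV_mult[OF this poly_DERIV[of r t]]
    show ?thesis
      unfolding F_def has_real_derivative_iff_has_vector_derivative[symmetric] p e[symmetric]
      by (rule DERIV_cong) (simp add: field_simps power2_eq_square)
  qed
  have "((\<lambda>t. poly ([:1, 0, -1:] * pderiv r - smult (d - 1) ([:0, 1:] * r)) t
            * (1 - t\<^sup>2) powr ((d - 3) / 2)) has_integral F 1 - F (-1)) {-1..1}"
    \<comment> \<open>For \<open>d < 3\<close>, \<open>F\<close> need not be differentiable at the
      end points; continuity there suffices.\<close>
    by (rule fundamental_theorem_of_calculus_interior[OF _ cont der]) auto
  then show ?thesis by (simp add: F_def)
qed

text \<open>Lagrange's identity: the integrand is the exact derivative treated before, with the
  Wronskian \<open>pderiv p * q - p * pderiv q\<close> as \<open>r\<close>.\<close>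

lemma gegenbauer_op_symmetric:
  fixes d :: real and p q :: "real poly"
  assumes "d > 1"
  shows "((\<lambda>t. poly (gegenbauer_op d p * q - p * gegenbauer_op d q) t
            * (1 - t\<^sup>2) powr ((d - 3) / 2)) has_integral 0) {-1..1}"
proof -
  have "poly (gegenbauer_op d p * q - p * gegenbauer_op d q) t =
      poly ([:1, 0, -1:] * pderiv (pderiv p * q - p * pderiv q)
        - smult (d - 1) ([:0, 1:] * (pderiv p * q - p * pderiv q))) t" for t
    by (simp add: gegenbauer_op_def pderiv_diff pderiv_mult) algebra
  then show ?thesis
    using has_integral_gegenbauer_boundary[OF assms, of "pderiv p * q - p * pderiv q"]
    by presburger
qed

text \<open>The middle half of the interval suffices: there the weight is continuous and positive
  for every exponent, so \<open>u\<close> vanishes on an infinite set.\<close>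

lemma poly_eq_0_if_weighted_square_integral_0:
  fixes u :: "real poly" and a :: real
  assumes "((\<lambda>t. poly (u * u) t * (1 - t\<^sup>2) powr a) has_integral 0) {-1..1}"
  shows "u = 0"
proof (rule ccontr)
  assume "u \<noteq> 0"
  let ?v = "\<lambda>t. poly (u * u) t * (1 - t\<^sup>2) powr a"
  have nonneg: "?v t \<ge> 0" for t by simp
  have pos: "1 - t\<^sup>2 > 0" if "t \<in> {-1/2..1/2}" for t :: real
    using that by (auto simp: abs_square_less_1 abs_if)
  have cont: "continuous_on {-1/2..1/2} ?v"
    using pos by (intro continuous_intros) force+
  have int: "?v integrable_on {-1/2..1/2}"
    by (rule integrable_continuous_interval[OF cont])
  have "integral {-1/2..1/2} ?v \<le> integral {-1..1} ?v"
    by (rule integral_subset_le[OF _ int has_integral_integrable[OF assms]])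
      (use nonneg in auto)
  then have "integral {-1/2..1/2} ?v = 0"
    using integral_nonneg[OF int nonneg] integral_unique[OF assms] by linarith
  then have int0: "(?v has_integral 0) (cbox (-1/2) (1/2))"
    using integrable_integral[OF int] unfolding box_real by metis
  have zero: "?v t = 0" if "t \<in> {-1/2..1/2}" for t
    by (rule has_integral_0_cbox_imp_0[OF _ nonneg int0])
      (use cont that in \<open>simp_all add: box_real\<close>)
  have "{-1/2..1/2} \<subseteq> {t. poly u t = 0}"
    using zero pos by fastforce
  moreover have "infinite {-1/2..1/2::real}" by (simp add: infinite_Icc)
  ultimately show False
    using poly_roots_finite[OF \<open>u \<noteq> 0\<close>] finite_subset by blast
qed

text \<open>
  This excludes \<open>Q 0 = 0\<close>, which the condition \<open>degree (Q 0) = 0\<close> permits; it is the only place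
  where the dimension itself matters, everything else only uses that \<open>Q j\<close> is nonnegative at \<open>1\<close>.
\<close>

lemma dim_Harm_0: "dim_Harm TYPE('n::finite) 0 = 1"
proof -
  let ?scale = "\<lambda>(c::real) p (x :: real ^ 'n). c * p x"
  let ?one = "\<lambda>x :: real ^ 'n. 1 :: real"
  interpret vector_space ?scale
    by unfold_locales (auto simp: algebra_simps fun_eq_iff)
  have const: "p = ?scale (p 0) ?one" if "p \<in> Harm 0" for p :: "real ^ 'n \<Rightarrow> real"
  proof
    fix x
    \<comment> \<open>Homogeneity at scale 0, with \<open>0 ^ 0 = 1\<close>, forces \<open>p\<close>
      to be constant.\<close>
    have "p (0 *\<^sub>R x) = 0 ^ 0 * p x" using that unfolding Harm_def by blast
    then show "p x = ?scale (p 0) ?one x" by simp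
  qed
  have "?one \<in> Harm 0"
    by (auto simp: Harm_def laplacian_def real_polynomial_function.intros numeral_2_eq_2)
  moreover have "Harm 0 \<subseteq> span {?one}"
  proof
    fix p :: "real ^ 'n \<Rightarrow> real" assume "p \<in> Harm 0"
    from const[OF this] show "p \<in> span {?one}"
      by (rule ssubst) (rule span_scale, rule span_base, rule singletonI)
  qed
  moreover have "independent {?one}"
    unfolding dependent_single by (simp add: fun_eq_iff)
  ultimately show ?thesis
    unfolding dim_Harm_def by (intro dim_unique[of "{?one}"]) simp_all
qed

section \<open>Orthogonality to lower degrees and the eigenvalue equation\<close>

lemma gegenbauer_family_orthogonal_lower_degree:
  assumes Q: "gegenbauer_family TYPE('n::finite) Q" and "p = 0 \<or> degree p < j"
  shows "((\<lambda>t. poly (Q j * p) t * (1 - t\<^sup>2) powr ((real CARD('n) - 3) / 2))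
            has_integral 0) {-1..1}"
  using assms(2)
\<comment> \<open>The measure separates \<open>0\<close> from the nonzero constants, which have the
  same \<open>degree\<close>.\<close>
proof (induction "if p = 0 then 0 else Suc (degree p)" arbitrary: p rule: less_induct)
  case less
  show ?case
  proof (cases "p = 0")
    case False
    define m where "m = degree p"
    define c where "c = lead_coeff p / lead_coeff (Q m)"
    define r where "r = p - smult c (Q m)"
    have "m < j" using less.prems False by (simp add: m_def)
    have deg: "degree (Q m) = m" and
      orth: "((\<lambda>t. poly (Q j) t * poly (Q m) t * (1 - t\<^sup>2) powr ((real CARD('n) - 3) / 2))
            has_integral 0) {-1..1}"
      using Q \<open>m < j\<close> by (auto simp: gegenbauer_family_def)
    have "Q m \<noteq> 0"
    proof (cases "m = 0")
      case True
      have "poly (Q 0) 1 = 1"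
        using Q by (simp add: gegenbauer_family_def dim_Harm_0)
      then show ?thesis using True by auto
    qed (use deg in auto)
    then have "lead_coeff (Q m) \<noteq> 0" by simp
    then have "coeff r m = 0"
      unfolding deg by (simp add: r_def c_def m_def deg[unfolded m_def])
    moreover have "degree r \<le> m"
      unfolding r_def m_def using deg by (intro degree_diff_le) (auto simp: m_def)
    ultimately have r: "r = 0 \<or> degree r < m"
      by (metis eq_zero_or_degree_less)
    then have "((\<lambda>t. poly (Q j * r) t * (1 - t\<^sup>2) powr ((real CARD('n) - 3) / 2))
            has_integral 0) {-1..1}"
      using \<open>m < j\<close> False by (intro less.hyps) (auto simp: m_def)
    from has_integral_add[OF has_integral_mult_right[OF orth, of c] this]
    show ?thesis
      by (simp add: r_def algebra_simps)
  qed simp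
qed

text \<open>The leading terms cancel in \<open>u\<close>, so \<open>u\<close> and its image under
  the operator have degree below \<open>j\<close>. By symmetry and orthogonality the weighted
  integral of \<open>u * u\<close> is then zero.\<close>

lemma gegenbauer_family_ode:
  assumes Q: "gegenbauer_family TYPE('n::finite) Q" and d: "CARD('n) \<ge> 2" and j: "j \<ge> 1"
  defines "D \<equiv> real CARD('n)"
  shows "gegenbauer_op D (Q j) = smult (- (real j * (real j + D - 2))) (Q j)"
proof -
  define u where "u = gegenbauer_op D (Q j) + smult (real j * (real j + D - 2)) (Q j)"
  have deg: "degree (Q j) = j" using Q by (simp add: gegenbauer_family_def)
  have "coeff u n = 0" if "n \<ge> j" for n
  proof (cases "n = j")
    case True
    then show ?thesis
      using deg by (simp add: u_def coeff_gegenbauer_op coeff_eq_0)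
  next
    case False
    then show ?thesis
      using deg that by (simp add: u_def coeff_gegenbauer_op coeff_eq_0)
  qed
  then have degu: "u = 0 \<or> degree u < j"
    by (metis leading_coeff_0_iff not_le)
  then have degSu: "gegenbauer_op D u = 0 \<or> degree (gegenbauer_op D u) < j"
  proof (cases "u = 0")
    case True
    then show ?thesis by (simp add: gegenbauer_op_def)
  next
    case False
    then have "coeff (gegenbauer_op D u) n = 0" if "n \<ge> j" for n
      using degu that by (simp add: coeff_gegenbauer_op coeff_eq_0)
    then show ?thesis
      by (metis leading_coeff_0_iff not_le)
  qed
  let ?w = "\<lambda>t. (1 - t\<^sup>2) powr ((D - 3) / 2)"
  have "((\<lambda>t. poly (gegenbauer_op D (Q j) * u - Q j * gegenbauer_op D u) t * ?w t)
            has_integral 0) {-1..1}"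
    using d by (intro gegenbauer_op_symmetric) (simp add: D_def)
  moreover have "((\<lambda>t. poly (Q j * gegenbauer_op D u) t * ?w t) has_integral 0) {-1..1}"
    unfolding D_def
    by (rule gegenbauer_family_orthogonal_lower_degree[OF Q degSu[unfolded D_def]])
  moreover have "((\<lambda>t. poly (Q j * u) t * ?w t) has_integral 0) {-1..1}"
    unfolding D_def by (rule gegenbauer_family_orthogonal_lower_degree[OF Q degu])
  ultimately have "((\<lambda>t. poly (gegenbauer_op D (Q j) * u - Q j * gegenbauer_op D u) t * ?w t
      + poly (Q j * gegenbauer_op D u) t * ?w t
      + (real j * (real j + D - 2)) * (poly (Q j * u) t * ?w t))
            has_integral 0 + 0 + (real j * (real j + D - 2)) * 0) {-1..1}"
    by (intro has_integral_add has_integral_mult_right)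
  moreover have "poly (gegenbauer_op D (Q j) * u - Q j * gegenbauer_op D u) t * ?w t
      + poly (Q j * gegenbauer_op D u) t * ?w t
      + (real j * (real j + D - 2)) * (poly (Q j * u) t * ?w t) = poly (u * u) t * ?w t" for t
  proof -
    have "poly u t = poly (gegenbauer_op D (Q j)) t + (real j * (real j + D - 2)) * poly (Q j) t"
      by (simp add: u_def)
    then have "poly (gegenbauer_op D (Q j)) t = poly u t - (real j * (real j + D - 2)) * poly (Q j) t"
      by simp
    then show ?thesis
      unfolding poly_diff poly_mult by algebra
  qed
  ultimately have "((\<lambda>t. poly (u * u) t * ?w t) has_integral 0) {-1..1}"
    by simp
  then have "u = 0" by (rule poly_eq_0_if_weighted_square_integral_0)
  then show ?thesis by (simp add: u_def add_eq_0_iff)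
qed

lemma gegenbauer_family_coeff_recurrence:
  assumes Q: "gegenbauer_family TYPE('n::finite) Q" and d: "CARD('n) \<ge> 2" and j: "j \<ge> 1"
  shows "real (n + 2) * real (n + 1) * coeff (Q j) (n + 2) =
     (real n * (real n + CARD('n) - 2) - real j * (real j + CARD('n) - 2)) * coeff (Q j) n"
proof -
  have "coeff (gegenbauer_op (real CARD('n)) (Q j)) n =
      - (real j * (real j + CARD('n) - 2)) * coeff (Q j) n"
    unfolding gegenbauer_family_ode[OF assms] coeff_smult ..
  then show ?thesis
    unfolding coeff_gegenbauer_op by algebra
qed

text \<open>Downward induction in steps of two from the vanishing coefficients above
  \<open>j\<close>: the factor in the recurrence is nonzero for \<open>n < j\<close>, and parity
  skips \<open>n = j\<close>.\<close>

lemma gegenbauer_family_coeff_parity: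
  assumes Q: "gegenbauer_family TYPE('n::finite) Q" and d: "CARD('n) \<ge> 2" and j: "j \<ge> 1"
    and "odd (j + n)"
  shows "coeff (Q j) n = 0"
  using \<open>odd (j + n)\<close>
proof (induction "j - n" arbitrary: n rule: less_induct)
  case less
  show ?case
  proof (cases "n < j")
    case True
    have "coeff (Q j) (n + 2) = 0"
      using less True by (intro less.hyps) auto
    then have "(real n * (real n + CARD('n) - 2) - real j * (real j + CARD('n) - 2)) * coeff (Q j) n = 0"
      using gegenbauer_family_coeff_recurrence[OF Q d j, of n] by simp
    moreover have "real n * (real n + CARD('n) - 2) < real j * (real j + CARD('n) - 2)"
    proof -
      have "real j * (real j + CARD('n) - 2) - real n * (real n + CARD('n) - 2) =
          (real j - real n) * (real j + real n + real CARD('n) - 2)"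
        by (simp add: algebra_simps)
      also have "\<dots> > 0"
        using True d by (intro mult_pos_pos) auto
      finally show ?thesis by simp
    qed
    ultimately show ?thesis by simp
  next
    case False
    then have "j < n" using less.prems by (metis linorder_neqE_nat odd_add)
    then show ?thesis using Q by (simp add: gegenbauer_family_def coeff_eq_0)
  qed
qed

section \<open>The Fischer inner product\<close>

text \<open>
  A polynomial on \<^typ>\<open>real ^ 'n\<close> is encoded by its coefficients, indexed by multi-indices
  \<^typ>\<open>'n \<Rightarrow> nat\<close>: \<open>raise i\<close> is multiplication by the \<open>i\<close>-th coordinate and \<open>lower i\<close> is the
  \<open>i\<close>-th partial derivative.  Finiteness of the support is never needed, because the Fischer
  product below only sees one homogeneous degree.
\<close>

definition raise :: "'n \<Rightarrow> (('n \<Rightarrow> nat) \<Rightarrow> real) \<Rightarrow> ('n \<Rightarrow> nat) \<Rightarrow> real" where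
  "raise i p = (\<lambda>\<alpha>. if \<alpha> i = 0 then 0 else p (\<alpha>(i := \<alpha> i - 1)))"

definition lower :: "'n \<Rightarrow> (('n \<Rightarrow> nat) \<Rightarrow> real) \<Rightarrow> ('n \<Rightarrow> nat) \<Rightarrow> real" where
  "lower i p = (\<lambda>\<alpha>. real (Suc (\<alpha> i)) * p (\<alpha>(i := Suc (\<alpha> i))))"

definition lin_mult :: "real ^ 'n \<Rightarrow> (('n \<Rightarrow> nat) \<Rightarrow> real) \<Rightarrow> ('n \<Rightarrow> nat) \<Rightarrow> real" where
  "lin_mult x p = (\<lambda>\<alpha>. \<Sum>i\<in>UNIV. x $ i * raise i p \<alpha>)"

definition dir_deriv :: "real ^ 'n \<Rightarrow> (('n \<Rightarrow> nat) \<Rightarrow> real) \<Rightarrow> ('n \<Rightarrow> nat) \<Rightarrow> real" where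
  "dir_deriv x p = (\<lambda>\<alpha>. \<Sum>i\<in>UNIV. x $ i * lower i p \<alpha>)"

definition sq_mult :: "(('n::finite \<Rightarrow> nat) \<Rightarrow> real) \<Rightarrow> ('n \<Rightarrow> nat) \<Rightarrow> real" where
  "sq_mult p = (\<lambda>\<alpha>. \<Sum>i\<in>UNIV. raise i (raise i p) \<alpha>)"

definition lap :: "(('n::finite \<Rightarrow> nat) \<Rightarrow> real) \<Rightarrow> ('n \<Rightarrow> nat) \<Rightarrow> real" where
  "lap p = (\<lambda>\<alpha>. \<Sum>i\<in>UNIV. lower i (lower i p) \<alpha>)"

definition euler :: "(('n::finite \<Rightarrow> nat) \<Rightarrow> real) \<Rightarrow> ('n \<Rightarrow> nat) \<Rightarrow> real" where
  "euler p = (\<lambda>\<alpha>. real (\<Sum>i\<in>UNIV. \<alpha> i) * p \<alpha>)"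

definition unit_coeffs :: "('n \<Rightarrow> nat) \<Rightarrow> real" where
  "unit_coeffs \<alpha> = (if \<alpha> = (\<lambda>_. 0) then 1 else 0)"

section \<open>Linearity and commutation relations of the operators\<close>

lemma raise_linear:
  "raise i (\<lambda>\<alpha>. p \<alpha> + q \<alpha>) = (\<lambda>\<alpha>. raise i p \<alpha> + raise i q \<alpha>)"
  "raise i (\<lambda>\<alpha>. c * p \<alpha>) = (\<lambda>\<alpha>. c * raise i p \<alpha>)"
  "raise i (\<lambda>\<alpha>. \<Sum>k\<in>K. P k \<alpha>) = (\<lambda>\<alpha>. \<Sum>k\<in>K. raise i (P k) \<alpha>)"
  by (auto simp: raise_def fun_eq_iff)

lemma lower_linear:
  "lower i (\<lambda>\<alpha>. p \<alpha> + q \<alpha>) = (\<lambda>\<alpha>. lower i p \<alpha> + lower i q \<alpha>)"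
  "lower i (\<lambda>\<alpha>. c * p \<alpha>) = (\<lambda>\<alpha>. c * lower i p \<alpha>)"
  "lower i (\<lambda>\<alpha>. \<Sum>k\<in>K. P k \<alpha>) = (\<lambda>\<alpha>. \<Sum>k\<in>K. lower i (P k) \<alpha>)"
  by (auto simp: lower_def fun_eq_iff algebra_simps sum_distrib_left)

lemma lin_mult_linear:
  "lin_mult x (\<lambda>\<alpha>. p \<alpha> + q \<alpha>) = (\<lambda>\<alpha>. lin_mult x p \<alpha> + lin_mult x q \<alpha>)"
  "lin_mult x (\<lambda>\<alpha>. c * p \<alpha>) = (\<lambda>\<alpha>. c * lin_mult x p \<alpha>)"
  by (auto simp: lin_mult_def raise_linear fun_eq_iff algebra_simps sum.distrib sum_distrib_left)

lemma sq_mult_linear: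
  "sq_mult (\<lambda>\<alpha>. p \<alpha> + q \<alpha>) = (\<lambda>\<alpha>. sq_mult p \<alpha> + sq_mult q \<alpha>)"
  "sq_mult (\<lambda>\<alpha>. c * p \<alpha>) = (\<lambda>\<alpha>. c * sq_mult p \<alpha>)"
  by (auto simp: sq_mult_def raise_linear fun_eq_iff algebra_simps sum.distrib sum_distrib_left)

lemma lap_linear:
  "lap (\<lambda>\<alpha>. p \<alpha> + q \<alpha>) = (\<lambda>\<alpha>. lap p \<alpha> + lap q \<alpha>)"
  "lap (\<lambda>\<alpha>. c * p \<alpha>) = (\<lambda>\<alpha>. c * lap p \<alpha>)"
  "lap (\<lambda>\<alpha>. \<Sum>k\<in>K. P k \<alpha>) = (\<lambda>\<alpha>. \<Sum>k\<in>K. lap (P k) \<alpha>)"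
  by (auto simp: lap_def lower_linear fun_eq_iff algebra_simps sum.distrib sum_distrib_left
      intro: sum.swap)

text \<open>The canonical commutation relation; the product rules for \<open>lower\<close>,
  \<open>dir_deriv\<close> and \<open>lap\<close> below reduce to it.\<close>

lemma lower_raise:
  "lower i (raise k p) = (\<lambda>\<alpha>. raise k (lower i p) \<alpha> + (if i = k then p \<alpha> else 0))"
proof
  fix \<alpha> :: "'a \<Rightarrow> nat"
  show "lower i (raise k p) \<alpha> = raise k (lower i p) \<alpha> + (if i = k then p \<alpha> else 0)"
    by (cases "\<alpha> k") (auto simp: lower_def raise_def fun_upd_twist fun_upd_idem algebra_simps)
qed

lemma lower_lin_mult:
  fixes x :: "real ^ 'n"
  shows "lower i (lin_mult x p) = (\<lambda>\<alpha>. lin_mult x (lower i p) \<alpha> + x $ i * p \<alpha>)"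
  by (simp add: lin_mult_def lower_linear lower_raise fun_eq_iff distrib_left sum.distrib
      if_distrib[of "(*) _"] cong: if_cong)

lemma lower_sq_mult:
  fixes p :: "('n::finite \<Rightarrow> nat) \<Rightarrow> real"
  shows "lower i (sq_mult p) = (\<lambda>\<alpha>. sq_mult (lower i p) \<alpha> + 2 * raise i p \<alpha>)"
proof -
  have *: "raise k (\<lambda>\<alpha>. if i = k then p \<alpha> else 0) \<alpha> = (if i = k then raise i p \<alpha> else 0)" for k \<alpha>
    by (auto simp: raise_def)
  show ?thesis
    by (simp add: sq_mult_def lower_linear lower_raise raise_linear fun_eq_iff sum.distrib *)
qed

lemma lap_lin_mult:
  "lap (lin_mult x p) = (\<lambda>\<alpha>. lin_mult x (lap p) \<alpha> + 2 * dir_deriv x p \<alpha>)"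
proof -
  have "lin_mult x (lap p) \<alpha> = (\<Sum>i\<in>UNIV. lin_mult x (lower i (lower i p)) \<alpha>)" for \<alpha>
    unfolding lin_mult_def lap_def raise_linear sum_distrib_left by (rule sum.swap)
  then show ?thesis
    by (simp add: lap_def lower_lin_mult lower_linear dir_deriv_def fun_eq_iff sum.distrib
        sum_distrib_left)
qed

lemma dir_deriv_lin_mult:
  "dir_deriv y (lin_mult x p) = (\<lambda>\<alpha>. lin_mult x (dir_deriv y p) \<alpha> + (x \<bullet> y) * p \<alpha>)"
proof -
  have "lin_mult x (dir_deriv y p) \<alpha> = (\<Sum>i\<in>UNIV. y $ i * lin_mult x (lower i p) \<alpha>)" for \<alpha>
    unfolding lin_mult_def dir_deriv_def raise_linear sum_distrib_left
    by (subst sum.swap) (simp add: mult_ac)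
  then show ?thesis
    by (simp add: dir_deriv_def lower_lin_mult fun_eq_iff sum.distrib distrib_left inner_vec_def
        sum_distrib_left mult_ac)
qed

lemma raise_lower_same: "raise i (lower i p) \<alpha> = real (\<alpha> i) * p \<alpha>"
  by (auto simp: raise_def lower_def fun_upd_idem)

text \<open>Product rule: \<open>z \<bullet> z\<close> has gradient \<open>2 z\<close> and Laplacian
  \<open>2 * CARD('n)\<close>, and \<open>euler\<close> is the operator
  \<open>z \<bullet> grad\<close>.\<close>

lemma lap_sq_mult:
  fixes p :: "('n::finite \<Rightarrow> nat) \<Rightarrow> real"
  shows "lap (sq_mult p) =
     (\<lambda>\<alpha>. sq_mult (lap p) \<alpha> + 4 * euler p \<alpha> + 2 * real CARD('n) * p \<alpha>)"
proof -
  have "sq_mult (lap p) \<alpha> = (\<Sum>i\<in>UNIV. sq_mult (lower i (lower i p)) \<alpha>)" for \<alpha>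
    unfolding sq_mult_def lap_def raise_linear by (rule sum.swap)
  then show ?thesis
    by (simp add: lap_def lower_sq_mult lower_linear lower_raise raise_lower_same fun_eq_iff
        sum.distrib euler_def sum_distrib_left sum_distrib_right algebra_simps)
qed

lemma euler_raise: "euler (raise i p) = (\<lambda>\<alpha>. raise i (euler p) \<alpha> + raise i p \<alpha>)"
proof
  fix \<alpha> :: "'a \<Rightarrow> nat"
  have "real (\<Sum>k\<in>UNIV. \<alpha> k) = real (\<Sum>k\<in>UNIV. (\<alpha>(i := \<alpha> i - 1)) k) + 1" if "\<alpha> i \<noteq> 0"
    using that by (simp add: sum.remove[of UNIV i])
  then show "euler (raise i p) \<alpha> = raise i (euler p) \<alpha> + raise i p \<alpha>"
    by (auto simp: euler_def raise_def algebra_simps)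
qed

lemma euler_linear:
  "euler (\<lambda>\<alpha>. c * p \<alpha>) = (\<lambda>\<alpha>. c * euler p \<alpha>)"
  "euler (\<lambda>\<alpha>. \<Sum>k\<in>K. P k \<alpha>) = (\<lambda>\<alpha>. \<Sum>k\<in>K. euler (P k) \<alpha>)"
  by (auto simp: euler_def fun_eq_iff sum_distrib_left)

lemma euler_lin_mult:
  "euler (lin_mult x p) = (\<lambda>\<alpha>. lin_mult x (euler p) \<alpha> + lin_mult x p \<alpha>)"
  by (simp add: lin_mult_def euler_linear euler_raise distrib_left sum.distrib)

lemma euler_sq_mult:
  "euler (sq_mult p) = (\<lambda>\<alpha>. sq_mult (euler p) \<alpha> + 2 * sq_mult p \<alpha>)"
  by (simp add: sq_mult_def euler_linear euler_raise raise_linear sum.distrib sum_distrib_left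
      algebra_simps)

text \<open>The polynomial \<open>z \<mapsto> (z \<bullet> z) ^ k * (x \<bullet> z) ^ m\<close>.\<close>

definition zonal :: "real ^ 'n \<Rightarrow> nat \<Rightarrow> nat \<Rightarrow> ('n \<Rightarrow> nat) \<Rightarrow> real" where
  "zonal x k m = (sq_mult ^^ k) ((lin_mult x ^^ m) unit_coeffs)"

lemma zonal_simps:
  "zonal x 0 0 = unit_coeffs"
  "zonal x 0 (Suc m) = lin_mult x (zonal x 0 m)"
  "zonal x (Suc k) m = sq_mult (zonal x k m)"
  by (auto simp: zonal_def)

lemma lower_unit_coeffs: "lower i unit_coeffs = (\<lambda>\<alpha>. 0)" "lower i (\<lambda>\<alpha>. 0) = (\<lambda>\<alpha>. 0)"
  by (auto simp: lower_def unit_coeffs_def fun_eq_iff)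

text \<open>Euler's identity in degree \<open>2 * k + m\<close>; it evaluates the
  \<open>euler\<close> term that \<open>lap_sq_mult\<close> produces.\<close>

lemma euler_zonal: "euler (zonal x k m) = (\<lambda>\<alpha>. real (2 * k + m) * zonal x k m \<alpha>)"
proof (induction k)
  case 0
  show ?case
  proof (induction m)
    case 0
    show ?case by (auto simp: zonal_simps euler_def unit_coeffs_def)
  next
    case (Suc m)
    then show ?case
      by (simp add: zonal_simps euler_lin_mult lin_mult_linear algebra_simps)
  qed
next
  case (Suc k)
  then show ?case
    by (simp add: zonal_simps euler_sq_mult sq_mult_linear algebra_simps)
qed

lemma dir_deriv_zonal:
  "dir_deriv y (zonal x 0 m) = (\<lambda>\<alpha>. real m * (x \<bullet> y) * zonal x 0 (m - 1) \<alpha>)"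
proof (induction m)
  case 0
  show ?case by (simp add: zonal_simps dir_deriv_def lower_unit_coeffs)
next
  case (Suc m)
  show ?case
  proof (cases m)
    case 0
    then show ?thesis
      using Suc by (simp add: zonal_simps dir_deriv_lin_mult lin_mult_linear)
        (simp add: lin_mult_def raise_def)
  next
    case (Suc m')
    then show ?thesis
      using Suc.IH by (simp add: zonal_simps dir_deriv_lin_mult lin_mult_linear algebra_simps)
  qed
qed

text \<open>Truncated subtraction is harmless: the factor \<open>m * (m - 1)\<close> vanishes
  wherever \<open>m - 2\<close> truncates.\<close>

lemma lap_zonal_0:
  "lap (zonal x 0 m) = (\<lambda>\<alpha>. real m * (real m - 1) * (x \<bullet> x) * zonal x 0 (m - 2) \<alpha>)"
proof (induction m)
  case 0
  show ?case by (simp add: zonal_simps lap_def lower_unit_coeffs)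
next
  case (Suc m)
  have *: "real m * (real m - 1) * (x \<bullet> x) * lin_mult x (zonal x 0 (m - 2)) \<alpha> =
      real m * (real m - 1) * (x \<bullet> x) * zonal x 0 (m - 1) \<alpha>" for \<alpha>
  proof (cases "m \<le> 1")
    case False
    then have "m - 1 = Suc (m - 2)" by simp
    then show ?thesis by (simp add: zonal_simps)
  qed (cases m; simp)
  have "lap (zonal x 0 (Suc m)) = (\<lambda>\<alpha>. lin_mult x (lap (zonal x 0 m)) \<alpha> + 2 * dir_deriv x (zonal x 0 m) \<alpha>)"
    by (simp add: zonal_simps lap_lin_mult)
  also have "\<dots> = (\<lambda>\<alpha>. real m * (real m - 1) * (x \<bullet> x) * zonal x 0 (m - 1) \<alpha>
      + 2 * (real m * (x \<bullet> x) * zonal x 0 (m - 1) \<alpha>))"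
    by (simp only: Suc.IH lin_mult_linear * dir_deriv_zonal)
  finally show ?case by (simp add: algebra_simps)
qed

text \<open>Passing from \<open>k\<close> to \<open>Suc k\<close> adds
  \<open>4 * (2 * k + m) + 2 * CARD('n)\<close> to the first coefficient.\<close>

lemma lap_zonal:
  fixes x :: "real ^ 'n"
  shows "lap (zonal x k m) =
     (\<lambda>\<alpha>. 2 * real k * (2 * real m + real CARD('n) + 2 * real k - 2) * zonal x (k - 1) m \<alpha>
        + real m * (real m - 1) * (x \<bullet> x) * zonal x k (m - 2) \<alpha>)"
proof (induction k)
  case 0
  show ?case by (simp add: lap_zonal_0)
next
  case (Suc k)
  have *: "c * real k * sq_mult (zonal x (k - 1) m) \<alpha> = c * real k * zonal x k m \<alpha>" for c \<alpha>
    by (cases k) (auto simp: zonal_simps)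
  have "lap (zonal x (Suc k) m) = (\<lambda>\<alpha>. sq_mult (lap (zonal x k m)) \<alpha>
      + 4 * euler (zonal x k m) \<alpha> + 2 * real CARD('n) * zonal x k m \<alpha>)"
    by (simp add: zonal_simps lap_sq_mult)
  also have "\<dots> = (\<lambda>\<alpha>. (2 * (2 * real m + real CARD('n) + 2 * real k - 2)) * real k * sq_mult (zonal x (k - 1) m) \<alpha>
      + real m * (real m - 1) * (x \<bullet> x) * zonal x (Suc k) (m - 2) \<alpha>
      + 4 * (real (2 * k + m) * zonal x k m \<alpha>) + 2 * real CARD('n) * zonal x k m \<alpha>)"
    by (simp only: Suc.IH sq_mult_linear zonal_simps euler_zonal)
      (simp add: mult_ac)
  also have "\<dots> = (\<lambda>\<alpha>. 2 * real (Suc k) * (2 * real m + real CARD('n) + 2 * real (Suc k) - 2) * zonal x k m \<alpha>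
        + real m * (real m - 1) * (x \<bullet> x) * zonal x (Suc k) (m - 2) \<alpha>)"
    unfolding * by (simp add: algebra_simps)
  finally show ?case by simp
qed

section \<open>The Fischer product and its adjoint pairs\<close>

definition multi_indices :: "nat \<Rightarrow> ('n::finite \<Rightarrow> nat) set" where
  "multi_indices m = {\<alpha>. (\<Sum>i\<in>UNIV. \<alpha> i) = m}"

text \<open>On homogeneous polynomials of degree \<open>m\<close> this is \<open>p\<close> applied
  to \<open>q\<close> as a differential operator.\<close>

definition fischer :: "nat \<Rightarrow> (('n::finite \<Rightarrow> nat) \<Rightarrow> real) \<Rightarrow> (('n \<Rightarrow> nat) \<Rightarrow> real) \<Rightarrow> real" where
  "fischer m p q = (\<Sum>\<alpha>\<in>multi_indices m. (\<Prod>i\<in>UNIV. fact (\<alpha> i)) * p \<alpha> * q \<alpha>)"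

lemma finite_multi_indices: "finite (multi_indices m :: ('n::finite \<Rightarrow> nat) set)"
proof (rule finite_subset)
  show "multi_indices m \<subseteq> (UNIV :: 'n set) \<rightarrow>\<^sub>E {..m}"
  proof
    fix \<alpha> :: "'n \<Rightarrow> nat" assume "\<alpha> \<in> multi_indices m"
    then have "\<alpha> i \<le> m" for i
      using member_le_sum[of i UNIV \<alpha>] by (simp add: multi_indices_def)
    then show "\<alpha> \<in> UNIV \<rightarrow>\<^sub>E {..m}" by auto
  qed
qed (auto intro: finite_PiE)

lemma fischer_commute: "fischer m p q = fischer m q p"
  by (simp add: fischer_def mult_ac)

lemma fischer_linear:
  "fischer m (\<lambda>\<alpha>. p \<alpha> + q \<alpha>) r = fischer m p r + fischer m q r"
  "fischer m (\<lambda>\<alpha>. c * p \<alpha>) r = c * fischer m p r"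
  "fischer m (\<lambda>\<alpha>. \<Sum>k\<in>K. P k \<alpha>) r = (\<Sum>k\<in>K. fischer m (P k) r)"
  "fischer m r (\<lambda>\<alpha>. p \<alpha> + q \<alpha>) = fischer m r p + fischer m r q"
  "fischer m r (\<lambda>\<alpha>. c * p \<alpha>) = c * fischer m r p"
  "fischer m r (\<lambda>\<alpha>. \<Sum>k\<in>K. P k \<alpha>) = (\<Sum>k\<in>K. fischer m r (P k))"
  by (auto simp: fischer_def sum_distrib_left sum_distrib_right sum.distrib algebra_simps
      intro: sum.swap)

lemma fischer_nonneg: "fischer m p p \<ge> 0"
  unfolding fischer_def by (intro sum_nonneg) (simp add: mult.assoc prod_nonneg)

text \<open>All terms of the square are nonnegative, so \<open>p\<close> vanishes on the
  multi-indices of degree \<open>m\<close>, the only ones that the product sees.\<close>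

lemma fischer_eq_0:
  assumes "fischer m p p = 0"
  shows "fischer m p q = 0"
proof -
  have "(\<Prod>i\<in>UNIV. fact (\<alpha> i)) * p \<alpha> * p \<alpha> = 0" if "\<alpha> \<in> multi_indices m" for \<alpha>
    using assms that unfolding fischer_def
    by (subst (asm) sum_nonneg_eq_0_iff) (auto simp: finite_multi_indices mult.assoc prod_nonneg)
  then show ?thesis
    unfolding fischer_def by (intro sum.neutral) auto
qed

text \<open>Raising the index at \<open>i\<close> multiplies \<open>fact (\<alpha> i)\<close> by
  \<open>Suc (\<alpha> i)\<close>, exactly the factor in \<open>lower\<close>; indices with
  \<open>\<alpha> i = 0\<close> contribute nothing.\<close>

lemma fischer_raise: "fischer (Suc m) (raise i p) q = fischer m p (lower i q)"
proof -
  let ?up = "\<lambda>\<alpha> :: 'a \<Rightarrow> nat. \<alpha>(i := Suc (\<alpha> i))"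
  have up: "?up ` multi_indices m = {\<alpha> \<in> multi_indices (Suc m). \<alpha> i \<noteq> 0}"
  proof (intro equalityI subsetI)
    fix \<alpha> assume "\<alpha> \<in> {\<alpha> \<in> multi_indices (Suc m). \<alpha> i \<noteq> 0}"
    then have "\<alpha>(i := \<alpha> i - 1) \<in> multi_indices m" "\<alpha> = ?up (\<alpha>(i := \<alpha> i - 1))"
      by (auto simp: multi_indices_def sum.remove[of UNIV i])
    then show "\<alpha> \<in> ?up ` multi_indices m" by blast
  qed (auto simp: multi_indices_def sum.remove[of UNIV i])
  have inj: "inj_on ?up (multi_indices m)"
    by (rule inj_onI) (metis fun_upd_triv fun_upd_upd fun_upd_same nat.inject)
  have "fischer (Suc m) (raise i p) q =
      (\<Sum>\<alpha>\<in>?up ` multi_indices m. (\<Prod>k\<in>UNIV. fact (\<alpha> k)) * raise i p \<alpha> * q \<alpha>)"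
    unfolding fischer_def up
    by (rule sum.mono_neutral_right) (auto simp: finite_multi_indices raise_def)
  also have "\<dots> = fischer m p (lower i q)"
    unfolding fischer_def sum.reindex[OF inj] o_def
    by (intro sum.cong refl) (simp add: raise_def lower_def prod.remove[of UNIV i] algebra_simps)
  finally show ?thesis .
qed

lemma fischer_lin_mult: "fischer (Suc m) (lin_mult x p) q = fischer m p (dir_deriv x q)"
  by (simp add: lin_mult_def dir_deriv_def fischer_linear fischer_raise)

lemma fischer_sq_mult: "fischer (Suc (Suc m)) (sq_mult p) q = fischer m p (lap q)"
  by (simp add: sq_mult_def lap_def fischer_linear fischer_raise)

text \<open>Reproducing property: each factor \<open>x \<bullet> z\<close> crosses over as a
  derivative along \<open>x\<close>, yielding \<open>x \<bullet> y\<close> and one factor of the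
  factorial.\<close>

lemma fischer_zonal_0: "fischer m (zonal x 0 m) (zonal y 0 m) = fact m * (x \<bullet> y) ^ m"
proof (induction m)
  case 0
  have "multi_indices 0 = {\<lambda>_ :: 'a. 0}" by (auto simp: multi_indices_def)
  then show ?case by (simp add: fischer_def zonal_simps unit_coeffs_def)
next
  case (Suc m)
  have "fischer (Suc m) (zonal x 0 (Suc m)) (zonal y 0 (Suc m)) =
      fischer m (zonal x 0 m) (dir_deriv x (zonal y 0 (Suc m)))"
    by (simp add: zonal_simps(2)[of x] fischer_lin_mult)
  also have "\<dots> = real (Suc m) * (y \<bullet> x) * fischer m (zonal x 0 m) (zonal y 0 m)"
    by (simp only: dir_deriv_zonal fischer_linear diff_Suc_1)
  finally show ?case using Suc by (simp add: inner_commute)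
qed

text \<open>Each \<open>z \<bullet> z\<close> crosses over as a Laplacian, yielding
  \<open>y \<bullet> y\<close> and two factors of the factorial.\<close>

lemma fischer_zonal:
  "fischer (m + 2 * k) (zonal x k m) (zonal y 0 (m + 2 * k)) =
     fact (m + 2 * k) * (x \<bullet> y) ^ m * (y \<bullet> y) ^ k"
proof (induction k)
  case 0
  show ?case by (simp add: fischer_zonal_0)
next
  case (Suc k)
  define M where "M = m + 2 * k"
  have "fischer (Suc (Suc M)) (zonal x (Suc k) m) (zonal y 0 (Suc (Suc M))) =
      fischer M (zonal x k m) (lap (zonal y 0 (Suc (Suc M))))"
    by (simp only: zonal_simps(3) fischer_sq_mult)
  also have "\<dots> = real (Suc (Suc M)) * (real (Suc (Suc M)) - 1) * (y \<bullet> y)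
      * fischer M (zonal x k m) (zonal y 0 M)"
    by (simp only: lap_zonal_0 fischer_linear) simp
  finally show ?case using Suc by (simp add: M_def)
qed

section \<open>Positive definiteness on the sphere\<close>

text \<open>
  The homogenization \<open>z \<mapsto> norm z ^ j * q (x \<bullet> sgn z)\<close> for \<open>norm x = 1\<close> and \<open>q\<close> of degree \<open>j\<close>
  with the parity of \<open>j\<close>.
\<close>

definition zonal_harmonic :: "nat \<Rightarrow> real poly \<Rightarrow> real ^ 'n \<Rightarrow> ('n \<Rightarrow> nat) \<Rightarrow> real" where
  "zonal_harmonic j q x =
     (\<lambda>\<alpha>. \<Sum>k\<le>j div 2. coeff q (j - 2 * k) * zonal x k (j - 2 * k) \<alpha>)"

text \<open>\<open>lap_zonal\<close> produces two terms from each summand. After an index shift they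
  pair up on a common zonal polynomial, and the recurrence cancels each pair.\<close>

lemma lap_zonal_harmonic:
  fixes x :: "real ^ 'n::finite"
  assumes rec: "\<And>n. real (n + 2) * real (n + 1) * coeff q (n + 2) =
     (real n * (real n + CARD('n) - 2) - real j * (real j + CARD('n) - 2)) * coeff q n"
    and x: "x \<bullet> x = 1"
  shows "lap (zonal_harmonic j q x) = (\<lambda>\<alpha>. 0)"
proof
  fix \<alpha> :: "'n \<Rightarrow> nat"
  define K where "K = j div 2"
  define F where "F k = coeff q (j - 2 * k) * (2 * real k
      * (2 * real (j - 2 * k) + real CARD('n) + 2 * real k - 2) * zonal x (k - 1) (j - 2 * k) \<alpha>)" for k
  define G where "G k = coeff q (j - 2 * k) * (real (j - 2 * k) * (real (j - 2 * k) - 1)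
      * zonal x k (j - 2 * k - 2) \<alpha>)" for k
  have "lap (zonal_harmonic j q x) \<alpha> = (\<Sum>k\<le>K. F k) + (\<Sum>k\<le>K. G k)"
    by (simp add: zonal_harmonic_def lap_linear lap_zonal x K_def F_def G_def sum.distrib distrib_left)
  also have "(\<Sum>k\<le>K. F k) = (\<Sum>k<K. F (Suc k))"
    by (simp add: sum.atMost_shift F_def)
  also have "(\<Sum>k\<le>K. G k) = (\<Sum>k<K. G k)"
  proof -
    \<comment> \<open>At the top index at most one factor \<open>x \<bullet> z\<close> is left,
      which kills \<open>G K\<close>.\<close>
    have "j - 2 * K = 0 \<or> j - 2 * K = 1" unfolding K_def by presburger
    then have "G K = 0" by (auto simp: G_def)
    then show ?thesis by (simp flip: lessThan_Suc_atMost)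
  qed
  also have "(\<Sum>k<K. F (Suc k)) + (\<Sum>k<K. G k) = (\<Sum>k<K. F (Suc k) + G k)"
    by (simp add: sum.distrib)
  also have "\<dots> = 0"
  proof (intro sum.neutral ballI)
    fix k assume "k \<in> {..<K}"
    then have "2 * k + 2 \<le> j" by (auto simp: K_def)
    then obtain n where j: "j = n + 2 * k + 2"
      by (metis add.commute add.left_commute le_Suc_ex)
    have "F (Suc k) + G k =
        (coeff q n * (2 * real (Suc k)) * (2 * real n + real CARD('n) + 2 * real k)
          + real (n + 2) * real (n + 1) * coeff q (n + 2)) * zonal x k n \<alpha>"
      by (simp add: F_def G_def j algebra_simps)
    \<comment> \<open>Here \<open>j - n = 2 * Suc k\<close>, and the factor in the recurrence is
      \<open>- (j - n) * (j + n + CARD('n) - 2)\<close>.\<close>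
    also have "real (n + 2) * real (n + 1) * coeff q (n + 2) =
        - (coeff q n * (2 * real (Suc k)) * (2 * real n + real CARD('n) + 2 * real k))"
      unfolding rec by (simp add: j algebra_simps)
    finally show "F (Suc k) + G k = 0" by simp
  qed
  finally show "lap (zonal_harmonic j q x) \<alpha> = 0" .
qed

lemma fischer_zonal_harmonic:
  fixes x y :: "real ^ 'n::finite"
  assumes rec: "\<And>n. real (n + 2) * real (n + 1) * coeff q (n + 2) =
     (real n * (real n + CARD('n) - 2) - real j * (real j + CARD('n) - 2)) * coeff q n"
    and parity: "\<And>n. odd (j + n) \<Longrightarrow> coeff q n = 0"
    and deg: "degree q = j"
    and x: "x \<bullet> x = 1" and y: "y \<bullet> y = 1"
  shows "fischer j (zonal_harmonic j q x) (zonal_harmonic j q y) =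
     coeff q j * fact j * poly q (x \<bullet> y)"
proof -
  let ?H = "zonal_harmonic j q x"
  \<comment> \<open>Harmonic polynomials are orthogonal to the multiples of \<open>z \<bullet> z\<close>, so only the term \<open>(y \<bullet> z) ^ j\<close>
     of the second factor survives.\<close>
  have 1: "fischer j ?H (zonal y k (j - 2 * k)) = 0" if "k \<in> {..j div 2} - {0}" for k
  proof -
    have "k = Suc (k - 1)" "j = Suc (Suc (j - 2))" using that by auto
    then obtain k' m where k: "k = Suc k'" and j: "j = Suc (Suc m)" by blast
    have "fischer j ?H (zonal y k (j - 2 * k)) = fischer m (zonal y k' (j - 2 * k)) (lap ?H)"
      by (simp only: k j zonal_simps(3) fischer_commute[of _ ?H] fischer_sq_mult
          fischer_commute[of _ "zonal_harmonic _ _ _"])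
    then show ?thesis
      by (simp add: lap_zonal_harmonic[OF rec x] fischer_def)
  qed
  have 2: "fischer j (zonal x k (j - 2 * k)) (zonal y 0 j) = fact j * (x \<bullet> y) ^ (j - 2 * k)"
    if "k \<le> j div 2" for k
    using fischer_zonal[of "j - 2 * k" k x y] that y by simp
  have "fischer j ?H (zonal_harmonic j q y) =
      (\<Sum>k\<le>j div 2. coeff q (j - 2 * k) * fischer j ?H (zonal y k (j - 2 * k)))"
    by (simp only: zonal_harmonic_def[of j q y] fischer_linear)
  also have "\<dots> = (\<Sum>k\<in>{0}. coeff q (j - 2 * k) * fischer j ?H (zonal y k (j - 2 * k)))"
    using 1 by (intro sum.mono_neutral_right) auto
  also have "\<dots> = coeff q j * (\<Sum>k\<le>j div 2. coeff q (j - 2 * k) * (fact j * (x \<bullet> y) ^ (j - 2 * k)))"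
    by (simp add: zonal_harmonic_def[of j q x] fischer_linear 2)
  also have "(\<Sum>k\<le>j div 2. coeff q (j - 2 * k) * (fact j * (x \<bullet> y) ^ (j - 2 * k))) =
      fact j * (\<Sum>k\<le>j div 2. coeff q (j - 2 * k) * (x \<bullet> y) ^ (j - 2 * k))"
    by (simp add: sum_distrib_left mult_ac)
  also have "(\<Sum>k\<le>j div 2. coeff q (j - 2 * k) * (x \<bullet> y) ^ (j - 2 * k)) =
      (\<Sum>n\<in>(\<lambda>k. j - 2 * k) ` {..j div 2}. coeff q n * (x \<bullet> y) ^ n)"
    by (subst sum.reindex) (auto simp: inj_on_def)
  \<comment> \<open>By parity the exponents not of the form \<open>j - 2 * k\<close> have zero
    coefficients.\<close>
  also have "\<dots> = (\<Sum>n\<le>j. coeff q n * (x \<bullet> y) ^ n)"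
  proof (intro sum.mono_neutral_left ballI)
    fix n assume n: "n \<in> {..j} - (\<lambda>k. j - 2 * k) ` {..j div 2}"
    have "odd (j + n)"
    proof
      assume "even (j + n)"
      then have "n = j - 2 * ((j - n) div 2)" "(j - n) div 2 \<le> j div 2"
        using n by auto
      with n show False by blast
    qed
    then show "coeff q n * (x \<bullet> y) ^ n = 0" using parity by simp
  qed auto
  also have "\<dots> = poly q (x \<bullet> y)"
    by (simp add: poly_altdef deg)
  finally show ?thesis by simp
qed

lemma gegenbauer_positive_definite:
  fixes u :: "'a \<Rightarrow> real ^ 'n::finite" and c :: "'a \<Rightarrow> real"
  assumes Q: "gegenbauer_family TYPE('n) Q" and d: "CARD('n) \<ge> 2" and j: "j \<ge> 1"
    and u: "\<And>x. x \<in> X \<Longrightarrow> norm (u x) = 1"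
  shows "(\<Sum>x\<in>X. \<Sum>y\<in>X. c x * c y * poly (Q j) (u x \<bullet> u y)) \<ge> 0"
proof -
  define q H where "q = Q j" and "H = (zonal_harmonic j q :: real ^ 'n \<Rightarrow> _)"
  have deg: "degree q = j" and Q1: "poly q 1 \<ge> 0"
    using Q by (auto simp: q_def gegenbauer_family_def)
  have fischer_H: "fischer j (H (u x)) (H (u y)) = coeff q j * fact j * poly q (u x \<bullet> u y)"
    if "x \<in> X" "y \<in> X" for x y
    unfolding H_def
    using gegenbauer_family_coeff_recurrence[OF Q d j] gegenbauer_family_coeff_parity[OF Q d j]
      deg u[OF that(1)] u[OF that(2)]
    by (intro fischer_zonal_harmonic) (auto simp: q_def norm_eq_1)
  have "coeff q j \<noteq> 0"
    using deg j by (metis degree_0 leading_coeff_0_iff not_one_le_zero)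
  show ?thesis
  proof (cases "poly q 1 = 0")
    case True
    \<comment> \<open>Each \<open>H (u x)\<close> is a null vector of the Fischer product.\<close>
    have "poly q (u x \<bullet> u y) = 0" if "x \<in> X" "y \<in> X" for x y
    proof -
      have "fischer j (H (u x)) (H (u x)) = 0"
        using fischer_H[of x x] u that True by (simp add: norm_eq_1)
      then have "fischer j (H (u x)) (H (u y)) = 0" by (rule fischer_eq_0)
      then show ?thesis using fischer_H that \<open>coeff q j \<noteq> 0\<close> by simp
    qed
    then show ?thesis by (simp add: q_def)
  next
    case False
    \<comment> \<open>The Fischer square of \<open>H (u x)\<close> fixes the sign. A point of
      \<open>X\<close> supplies the unit vector, hence the separate case of empty
      \<open>X\<close>.\<close>
    have "coeff q j > 0" if "x \<in> X" for x
    proof -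
      have "0 \<le> coeff q j * (fact j * poly q 1)"
        using fischer_nonneg[of j "H (u x)"] fischer_H[of x x] u that by (simp add: norm_eq_1 mult.assoc)
      moreover have "fact j * poly q 1 > 0" using False Q1 by simp
      ultimately show ?thesis
        using \<open>coeff q j \<noteq> 0\<close> by (simp add: zero_le_mult_iff)
    qed
    then consider "X = {}" | "coeff q j > 0" by blast
    then show ?thesis
    proof cases
      case 2
      let ?S = "\<Sum>x\<in>X. \<Sum>y\<in>X. c x * c y * poly q (u x \<bullet> u y)"
      have "0 \<le> fischer j (\<lambda>\<alpha>. \<Sum>x\<in>X. c x * H (u x) \<alpha>) (\<lambda>\<alpha>. \<Sum>x\<in>X. c x * H (u x) \<alpha>)"
        by (rule fischer_nonneg)
      also have "\<dots> = (\<Sum>x\<in>X. \<Sum>y\<in>X. c x * c y * fischer j (H (u x)) (H (u y)))"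
        by (simp only: fischer_linear sum_distrib_left mult.assoc)
      also have "\<dots> = (coeff q j * fact j) * ?S"
        by (simp add: fischer_H sum_distrib_left mult_ac)
      finally show ?thesis
        using mult_pos_pos[OF 2 fact_gt_zero[of j]] by (simp only: zero_le_mult_iff q_def) linarith
    qed simp
  qed
qed

section \<open>The energy bound\<close>

lemma has_sum_finite_sum:
  fixes f :: "'a \<Rightarrow> 'b \<Rightarrow> 'c :: topological_comm_monoid_add"
  assumes "\<And>x. x \<in> X \<Longrightarrow> (f x has_sum s x) A"
  shows "((\<lambda>a. \<Sum>x\<in>X. f x a) has_sum (\<Sum>x\<in>X. s x)) A"
  using assms by (induction X rule: infinite_finite_induct) (auto intro: has_sum_add)

theorem theorem1p5:
  fixes X :: "(real ^ 'n) set"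
    and w :: "real ^ 'n \<Rightarrow> real"
    and Q :: "nat \<Rightarrow> real poly"
    and f :: "real \<Rightarrow> real \<Rightarrow> real \<Rightarrow> real"
    and g0 :: "real \<Rightarrow> real \<Rightarrow> real"
    and g :: "nat \<Rightarrow> nat \<Rightarrow> real \<Rightarrow> real"
  assumes d: "CARD('n) \<ge> 2"
    and X: "finite X" "0 \<notin> X"
    and w: "\<And>x. x \<in> X \<Longrightarrow> w x > 0"
    and Q: "gegenbauer_family TYPE('n) Q"
    and h_converges: "\<And>r s t. r \<in> norm ` X \<Longrightarrow> s \<in> norm ` X \<Longrightarrow> t \<in> {-1..1} \<Longrightarrow>
           h_term g Q r s t summable_on UNIV \<times> {1..}"
    and f_ge_h: "\<And>r s t. r \<in> norm ` X \<Longrightarrow> s \<in> norm ` X \<Longrightarrow> t \<in> {-1..1} \<Longrightarrow>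
           f r s t \<ge> h_fun g0 g Q r s t"
  shows "potential_energy f X w \<ge>
           (\<Sum>x\<in>X. \<Sum>y\<in>X. w x * w y * g0 (norm x) (norm y))
             - (\<Sum>x\<in>X. (w x)\<^sup>2 * h_fun g0 g Q (norm x) (norm x) 1) \<and>
         (potential_energy f X w =
           (\<Sum>x\<in>X. \<Sum>y\<in>X. w x * w y * g0 (norm x) (norm y))
             - (\<Sum>x\<in>X. (w x)\<^sup>2 * h_fun g0 g Q (norm x) (norm x) 1)
          \<longleftrightarrow>
           (\<forall>x\<in>X. \<forall>y\<in>X. x \<noteq> y \<longrightarrow>
              f (norm x) (norm y) (sgn x \<bullet> sgn y) = h_fun g0 g Q (norm x) (norm y) (sgn x \<bullet> sgn y)) \<and>
           (\<forall>i j. j \<ge> 1 \<longrightarrow>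
              (\<Sum>x\<in>X. \<Sum>y\<in>X. w x * w y * g i j (norm x) * g i j (norm y)
                 * poly (Q j) (sgn x \<bullet> sgn y)) = 0))"
proof -
  define h where "h x y = h_fun g0 g Q (norm x) (norm y) (sgn x \<bullet> sgn y)" for x y :: "real ^ 'n"
  define T where "T = (\<lambda>(i, j). \<Sum>x\<in>X. \<Sum>y\<in>X. w x * w y * g i j (norm x) * g i j (norm y)
                 * poly (Q j) (sgn x \<bullet> sgn y))"
  define \<Delta> where "\<Delta> x y = w x * w y * (f (norm x) (norm y) (sgn x \<bullet> sgn y) - h x y)"
    for x y :: "real ^ 'n"
  define G0 where "G0 = (\<Sum>x\<in>X. \<Sum>y\<in>X. w x * w y * g0 (norm x) (norm y))"
  define D where "D = (\<Sum>x\<in>X. (w x)\<^sup>2 * h_fun g0 g Q (norm x) (norm x) 1)"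
  let ?I = "UNIV \<times> {1..} :: (nat \<times> nat) set"
  have unit: "norm (sgn x) = 1" if "x \<in> X" for x
    using that X(2) by (auto simp: norm_sgn)
  have inner_range: "sgn x \<bullet> sgn y \<in> {-1..1}" if "x \<in> X" "y \<in> X" for x y
    using Cauchy_Schwarz_ineq2[of "sgn x" "sgn y"] unit that by (auto simp: abs_le_iff)

  have T_nonneg: "T ij \<ge> 0" if "ij \<in> ?I" for ij
  proof -
    obtain i j where ij: "ij = (i, j)" by force
    \<comment> \<open>Weights and radial factors merge into the coefficients of the quadratic
      form.\<close>
    have "T ij = (\<Sum>x\<in>X. \<Sum>y\<in>X. (w x * g i j (norm x)) * (w y * g i j (norm y))
                 * poly (Q j) (sgn x \<bullet> sgn y))"
      by (simp add: T_def ij mult_ac)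
    also have "\<dots> \<ge> 0"
      using that by (intro gegenbauer_positive_definite[OF Q d]) (auto simp: ij unit)
    finally show ?thesis .
  qed
  \<comment> \<open>The diagonal is included here; positive definiteness concerns the full double
    sum.\<close>
  define S where "S = (\<Sum>x\<in>X. \<Sum>y\<in>X. w x * w y * h x y) - G0"
  have T_sum: "(T has_sum S) ?I"
  proof -
    have "((\<lambda>ij. (w x * w y) * h_term g Q (norm x) (norm y) (sgn x \<bullet> sgn y) ij) has_sum
        ((w x * w y) * (h x y - g0 (norm x) (norm y)))) ?I" if "x \<in> X" "y \<in> X" for x y
      using has_sum_infsum[OF h_converges[OF _ _ inner_range[OF that]]] that
      by (intro has_sum_cmult_right) (simp add: h_def h_fun_def)
    then have "((\<lambda>ij. \<Sum>x\<in>X. \<Sum>y\<in>X. (w x * w y) * h_term g Q (norm x) (norm y) (sgn x \<bullet> sgn y) ij) has_sum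
        (\<Sum>x\<in>X. \<Sum>y\<in>X. (w x * w y) * (h x y - g0 (norm x) (norm y)))) ?I"
      by (intro has_sum_finite_sum) auto
    moreover have "(\<lambda>ij. \<Sum>x\<in>X. \<Sum>y\<in>X. (w x * w y) * h_term g Q (norm x) (norm y) (sgn x \<bullet> sgn y) ij) = T"
      by (auto simp: T_def h_term_def mult.assoc fun_eq_iff)
    moreover have "(\<Sum>x\<in>X. \<Sum>y\<in>X. (w x * w y) * (h x y - g0 (norm x) (norm y))) = S"
      by (simp add: S_def G0_def right_diff_distrib sum_subtractf)
    ultimately show ?thesis by simp
  qed
  have S_nonneg: "S \<ge> 0"
    using T_sum T_nonneg by (rule has_sum_nonneg)
  have S_eq_0: "S = 0 \<longleftrightarrow> (\<forall>i j. j \<ge> 1 \<longrightarrow> T (i, j) = 0)"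
  proof
    assume "S = 0"
    then have "T ij = 0" if "ij \<in> ?I" for ij
      by (intro nonneg_has_sum_le_0D[OF T_sum _ T_nonneg that]) auto
    then show "\<forall>i j. j \<ge> 1 \<longrightarrow> T (i, j) = 0" by auto
  next
    assume "\<forall>i j. j \<ge> 1 \<longrightarrow> T (i, j) = 0"
    then have "(T has_sum 0) ?I" by (intro has_sum_0) auto
    with T_sum show "S = 0" by (rule has_sum_unique)
  qed

  have \<Delta>_nonneg: "\<Delta> x y \<ge> 0" if "x \<in> X" "y \<in> X" for x y
    unfolding \<Delta>_def h_def
    using f_ge_h[OF _ _ inner_range[OF that]] w[OF that(1)] w[OF that(2)] that
    by (intro mult_nonneg_nonneg) (simp_all add: less_imp_le)
  define E where "E = (\<Sum>x\<in>X. \<Sum>y\<in>X - {x}. \<Delta> x y)"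
  have E_nonneg: "E \<ge> 0"
    unfolding E_def by (intro sum_nonneg \<Delta>_nonneg) auto
  have E_eq_0: "E = 0 \<longleftrightarrow> (\<forall>x\<in>X. \<forall>y\<in>X. x \<noteq> y \<longrightarrow>
      f (norm x) (norm y) (sgn x \<bullet> sgn y) = h x y)"
  proof -
    have \<Delta>_eq_0: "\<Delta> x y = 0 \<longleftrightarrow> f (norm x) (norm y) (sgn x \<bullet> sgn y) = h x y"
      if "x \<in> X" "y \<in> X" for x y
      using w[OF that(1)] w[OF that(2)] by (simp add: \<Delta>_def)
    have "E = 0 \<longleftrightarrow> (\<forall>x\<in>X. (\<Sum>y\<in>X - {x}. \<Delta> x y) = 0)"
      unfolding E_def using X(1) \<Delta>_nonneg by (intro sum_nonneg_eq_0_iff sum_nonneg) auto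
    also have "\<dots> \<longleftrightarrow> (\<forall>x\<in>X. \<forall>y\<in>X - {x}. \<Delta> x y = 0)"
      using X(1) \<Delta>_nonneg by (intro ball_cong refl sum_nonneg_eq_0_iff) auto
    finally show ?thesis
      by (metis \<Delta>_eq_0 DiffE DiffI singletonD singletonI)
  qed

  have "potential_energy f X w = E + (\<Sum>x\<in>X. \<Sum>y\<in>X - {x}. w x * w y * h x y)"
    unfolding potential_energy_def E_def sum.distrib[symmetric] \<Delta>_def
    by (intro sum.cong refl) (simp add: algebra_simps)
  \<comment> \<open>The removed diagonal is \<open>D\<close>, since \<open>sgn x\<close> is a unit
    vector.\<close>
  also have "(\<Sum>x\<in>X. \<Sum>y\<in>X - {x}. w x * w y * h x y) = (\<Sum>x\<in>X. \<Sum>y\<in>X. w x * w y * h x y) - D"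
  proof -
    have "sgn x \<bullet> sgn x = 1" if "x \<in> X" for x
      using unit[OF that] by (simp add: norm_eq_1)
    then show ?thesis
      unfolding D_def sum_subtractf[symmetric] using X(1)
      by (intro sum.cong refl) (simp add: sum_diff1 h_def power2_eq_square)
  qed
  finally have "potential_energy f X w = (G0 - D) + (E + S)"
    by (simp add: S_def)
  then have "potential_energy f X w \<ge> G0 - D \<and>
      (potential_energy f X w = G0 - D \<longleftrightarrow> E = 0 \<and> S = 0)"
    using E_nonneg S_nonneg by linarith
  then show ?thesis
    unfolding E_eq_0 S_eq_0 by (simp add: G0_def D_def h_def T_def)
qed

end
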